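(* Let $X\subseteq\mathbb{R}^n$ be closed and convex, let $f_1,\dots,f_m:\mathbb{R}^n\to\mathbb{R}$ be convex, let $f=\sum_{i=1}^m f_i$, and assume that $f^*=\inf_{x\in X}f(x)$ is finite. Assume that for every $i$ the set of subgradients of $f_i$ at each $x\in X$ is nonempty and uniformly bounded over $X$ by a constant $C_i$, i.e. $\|v\|\le C_i$ for every subgradient $v$ of $f_i$ at every point $x\in X$. Let $\{x_k\}$ be generated by the cyclic incremental stochastic subgradient method with constant step-size $\alpha>0$: $$z_{0,k+1}=z_{m,k}=x_k,\qquad z_{i,k+1}=\mathcal{P}_X\big[z_{i-1,k+1}-\alpha\big(\nabla f_i(z_{i-1,k+1})+\epsilon_{i,k+1}\big)\big]\ (i=1,\dots,m),\qquad k\ge 0,$$ so that $x_{k+1}=z_{m,k+1}$, where $x_0\in X$ is a random initial vector and the $\epsilon_{i,k+1}$ are random noise vectors. Assume that the subgradient errors have zero conditional mean and bounded conditional second moments: there is a deterministic nonnegative scalar sequence $\{\nu_k\}$ such that for all $i\in\{1,\dots,m\}$ and $k\ge1$, $$\mathsf{E}[\epsilon_{i,k}\mid F_k^{i-1}]=0,\qquad \mathsf{E}\big[\|\epsilon_{i,k}\|^2\mid F_k^{i-1}\big]\le\nu_k^2 ,\qquad\text{and}\qquad \nu=\sup_{k\ge1}\nu_k<\infty .$$ Then $$\liminf_{k\to\infty}\mathsf{E}[f(x_k)]\le f^*+\frac{\alpha}{2}\Big(\sum_{i=1}^m C_i+m\nu\Big)^2,$$ and, with probability 1, $$\inf_{k\ge0}f(x_k)\le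 f^*+\frac{\alpha}{2}\Big(\sum_{i=1}^m C_i+m\nu\Big)^2 .$$
   Context: $\|\cdot\|$ is the Euclidean norm and $\mathcal{P}_X$ is the Euclidean projection onto $X$. A vector $v$ is a subgradient of a convex function $g:\mathbb{R}^n\to\mathbb{R}$ at $x$ if $v^T(y-x)\le g(y)-g(x)$ for all $y\in\mathbb{R}^n$; $\nabla f_i(x)$ denotes a subgradient of $f_i$ at $x$. $F_k^i$ is the $\sigma$-algebra generated by $x_0$ and the subgradient errors $\epsilon_{1,1},\dots,\epsilon_{i,k}$ in order of occurrence (all errors of cycles $1,\dots,k-1$ and the errors $\epsilon_{1,k},\dots,\epsilon_{i,k}$ of cycle $k$), with $F_k^0=F_{k-1}^m$ and $F_0^m=\sigma(x_0)$. The set $X$ is not assumed bounded, and the set of minimizers of $f$ over $X$ may be empty.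
   Formalization: The bound on liminf E[f(x_k)] is stated for E[f(x_0)] finite, since otherwise E[f(x_k)] is infinite for every k and the bound fails; the chosen subgradients are required to be measurable with respect to the history F_{k+1}^{i-1}, so that the iterates are random vectors. *)

theory Defs
  imports "HOL-Probability.Probability"
begin

definition subdifferential :: "('a::real_inner \<Rightarrow> real) \<Rightarrow> 'a \<Rightarrow> 'a set" where
  "subdifferential g x = {v. \<forall>y. v \<bullet> (y - x) \<le> g y - g x}"

(* Conditional expectation of a random vector, taken coordinate by coordinate. *)
definition vec_cond_exp ::
    "'w measure \<Rightarrow> 'w measure \<Rightarrow> ('w \<Rightarrow> real ^ 'n) \<Rightarrow> 'w \<Rightarrow> real ^ 'n" where
  "vec_cond_exp M F Y = (\<lambda>\<omega>. \<chi> j. real_cond_exp M F (\<lambda>\<omega>'. Y \<omega>' $ j) \<omega>)"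

(* error_history M m x0 eps k i is the sigma-algebra F_k^i on space M, generated by x0, by all
   errors of cycles 1, ..., k-1 and by the first i errors of cycle k. Cycles are numbered from 1,
   so for k = 0 it is generated by x0 alone. *)
definition error_history ::
    "'w measure \<Rightarrow> nat \<Rightarrow> ('w \<Rightarrow> real ^ 'n) \<Rightarrow> (nat \<Rightarrow> nat \<Rightarrow> 'w \<Rightarrow> real ^ 'n) \<Rightarrow>
      nat \<Rightarrow> nat \<Rightarrow> 'w measure" where
  "error_history M m x0 eps k i =
    sigma (space M)
      ({x0 -` A \<inter> space M | A. A \<in> sets borel} \<union>
       {eps j l -` A \<inter> space M | j l A. A \<in> sets borel \<and> j \<in> {1..m} \<and> 1 \<le> l \<and>
          (l < k \<or> l = k \<and> j \<le> i)})"

lemma error_history_Suc_0: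
  "error_history M m x0 eps (Suc k) 0 = error_history M m x0 eps k m"
proof -
  have "j \<in> {1..m} \<and> 1 \<le> l \<and> (l < Suc k \<or> l = Suc k \<and> j \<le> 0) \<longleftrightarrow>
        j \<in> {1..m} \<and> 1 \<le> l \<and> (l < k \<or> l = k \<and> j \<le> m)" for j l :: nat
    by auto
  then show ?thesis
    unfolding error_history_def by presburger
qed

end

theory Submission
  imports Defs
begin

text \<open>
  The proof follows the squared distance from the iterates to a comparison point \<open>Y\<close> of \<open>X\<close>.
  Projections onto \<open>X\<close> are nonexpansive, so one step with subgradient \<open>w\<close> and error \<open>e\<close> increases
  the squared distance by at most \<open>-2\<alpha>(z - Y)\<^sup>T(w + e) + \<alpha>\<^sup>2\<parallel>w + e\<parallel>\<^sup>2\<close>. The subgradient inequality turns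
  \<open>(z - Y)\<^sup>Tw\<close> into a gain in function value at \<open>z\<close>; replacing \<open>z\<close> by the point \<open>x k\<close> that starts
  the cycle costs the Lipschitz constant \<open>C i\<close> times the distance travelled inside the cycle.
  In expectation the term with \<open>e\<close> vanishes, the travelled distance is at most
  \<open>\<alpha> * (\<Sum>j<i. C j + \<nu>)\<close>, and the squares and cross terms of the \<open>m\<close> steps add up to
  \<open>\<alpha>\<^sup>2 * (\<Sum>i. C i + \<nu>)\<^sup>2\<close>. This is \<open>expected_descent_cycle\<close>: for every event \<open>G\<close> known at the start of
  the cycle,
  \<open>E[1\<^sub>G \<parallel>x (k+1) - Y\<parallel>\<^sup>2] \<le> E[1\<^sub>G \<parallel>x k - Y\<parallel>\<^sup>2] - 2\<alpha> E[1\<^sub>G (f (x k) - f Y)] + \<alpha>\<^sup>2 (\<Sum>i. C i + \<nu>)\<^sup>2 P(G)\<close>.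
  Working with the events \<open>G\<close> replaces conditioning on the past by ordinary integrals.

  Summing over the cycles, along a decreasing sequence of events, bounds
  the partial sums of \<open>\<Sum>k. E[1\<^sub>G (f (x k) - f Y - \<alpha>/2 (\<Sum>i. C i + \<nu>)\<^sup>2)]\<close> from above by a constant (\<open>telescoped_descent\<close>). Both claims
  follow, since otherwise the terms of this sum would eventually stay above a positive number.

  The initial point need not be square integrable, so a fixed \<open>Y\<close> could be at infinite
  mean square distance. The comparison point is therefore random: a near-minimizer \<open>v\<close> where
  \<open>\<parallel>x 0\<parallel> \<le> R\<close>, and \<open>x 0\<close> itself elsewhere. It is known at time \<open>0\<close>, lies within bounded distance of
  \<open>x 0\<close>, and if \<open>f (x 0)\<close> is integrable then \<open>E[f Y]\<close> tends to \<open>f v\<close> as \<open>R\<close> grows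
  (\<open>expectation_anchor_tendsto\<close>). For the expectations, \<open>G\<close> is the whole space. For the
  almost sure bound, \<open>G k\<close> is the event that \<open>\<parallel>x 0\<parallel> \<le> R\<close> and that all values up to time \<open>k\<close>
  exceed the bound by \<open>\<eta>\<close>; there \<open>Y = v\<close>, and the probabilities must decrease to \<open>0\<close>.
\<close>

section \<open>One projected subgradient step\<close>

lemma subgradient_lower_lipschitz:
  fixes h :: "'a::real_inner \<Rightarrow> real"
  assumes "subdifferential h u \<noteq> {}"
    and "\<And>w. w \<in> subdifferential h u \<Longrightarrow> norm w \<le> c"
  shows "h u - h v \<le> c * norm (u - v)"
proof -
  obtain w where w: "w \<in> subdifferential h u" using assms(1) by auto
  then have "w \<bullet> (v - u) \<le> h v - h u" by (auto simp: subdifferential_def)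
  then have "h u - h v \<le> w \<bullet> (u - v)" by (simp add: inner_diff_right)
  also have "\<dots> \<le> norm w * norm (u - v)" by (rule norm_cauchy_schwarz)
  also have "\<dots> \<le> c * norm (u - v)" using assms(2)[OF w] by (simp add: mult_right_mono)
  finally show ?thesis .
qed

text \<open>
  The value gain is measured at \<open>x\<close> rather than at the current point \<open>v\<close>: in the method, \<open>x\<close> is the
  start of the cycle, where all the summands have to be evaluated together. The error enters
  linearly only through \<open>(v - y) \<bullet> e\<close>, which has mean zero because \<open>v - y\<close> is known before \<open>e\<close> is.
\<close>

lemma projected_subgradient_step:
  fixes h :: "'a::euclidean_space \<Rightarrow> real" and e :: 'a
  assumes X: "closed X" "convex X" and v: "v \<in> X" and y: "y \<in> X" and x: "x \<in> X"
    and ex: "\<And>u. u \<in> X \<Longrightarrow> subdifferential h u \<noteq> {}"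
    and bound: "\<And>u w. u \<in> X \<Longrightarrow> w \<in> subdifferential h u \<Longrightarrow> norm w \<le> c"
    and w: "w \<in> subdifferential h v" and \<alpha>: "\<alpha> > 0"
  defines "p \<equiv> closest_point X (v - \<alpha> *\<^sub>R (w + e))"
  shows "(norm (p - y))\<^sup>2 \<le> (norm (v - y))\<^sup>2 - 2 * \<alpha> * (h x - h y)
           + 2 * \<alpha> * c * norm (v - x) - 2 * \<alpha> * ((v - y) \<bullet> e) + \<alpha>\<^sup>2 * (c + norm e)\<^sup>2"
    and "norm (p - v) \<le> \<alpha> * (c + norm e)"
proof -
  have nonexp: "norm (p - u) \<le> norm (v - \<alpha> *\<^sub>R (w + e) - u)" if "u \<in> X" for u
    using closest_point_lipschitz[OF X(2,1), of "v - \<alpha> *\<^sub>R (w + e)" u] that closest_point_self[OF that]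
    unfolding p_def by (auto simp: dist_norm)
  have we: "norm (w + e) \<le> c + norm e"
    using norm_triangle_ineq[of w e] bound[OF v w] by linarith
  have "norm (p - v) \<le> \<alpha> * norm (w + e)"
    using nonexp[OF v] \<alpha> by simp
  also have "\<dots> \<le> \<alpha> * (c + norm e)" using we \<alpha> by simp
  finally show "norm (p - v) \<le> \<alpha> * (c + norm e)" .
  have sub: "(v - y) \<bullet> w \<ge> h v - h y"
    using w by (auto simp: subdifferential_def inner_diff_left inner_diff_right inner_commute dest: spec[of _ y])
  have lip: "h x - h v \<le> c * norm (v - x)"
    using subgradient_lower_lipschitz[OF ex[OF x] bound[OF x], of v] by (simp add: norm_minus_commute)
  have "(norm (p - y))\<^sup>2 \<le> (norm ((v - y) - \<alpha> *\<^sub>R (w + e)))\<^sup>2"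
    using nonexp[OF y] by (intro power_mono) (auto simp: algebra_simps)
  also have "\<dots> = (norm (v - y))\<^sup>2 - 2 * \<alpha> * ((v - y) \<bullet> w) - 2 * \<alpha> * ((v - y) \<bullet> e) + \<alpha>\<^sup>2 * (norm (w + e))\<^sup>2"
    unfolding power2_norm_eq_inner
    by (simp add: algebra_simps inner_diff_left inner_diff_right inner_add_left inner_add_right inner_commute power2_eq_square)
  also have "\<dots> \<le> (norm (v - y))\<^sup>2 - 2 * \<alpha> * (h x - c * norm (v - x) - h y) - 2 * \<alpha> * ((v - y) \<bullet> e)
      + \<alpha>\<^sup>2 * (c + norm e)\<^sup>2"
  proof -
    have "2 * \<alpha> * (h x - c * norm (v - x) - h y) \<le> 2 * \<alpha> * ((v - y) \<bullet> w)"
      using sub lip \<alpha> by (intro mult_left_mono) auto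
    moreover have "\<alpha>\<^sup>2 * (norm (w + e))\<^sup>2 \<le> \<alpha>\<^sup>2 * (c + norm e)\<^sup>2"
      using we by (intro mult_left_mono power_mono) auto
    ultimately show ?thesis by linarith
  qed
  finally show "(norm (p - y))\<^sup>2 \<le> (norm (v - y))\<^sup>2 - 2 * \<alpha> * (h x - h y)
           + 2 * \<alpha> * c * norm (v - x) - 2 * \<alpha> * ((v - y) \<bullet> e) + \<alpha>\<^sup>2 * (c + norm e)\<^sup>2"
    by (simp add: algebra_simps)
qed

lemma borel_measurable_component:
  fixes W :: "'a \<Rightarrow> real ^ 'n"
  assumes "W \<in> borel_measurable H"
  shows "(\<lambda>\<omega>. W \<omega> $ j) \<in> borel_measurable H"
  unfolding cart_eq_inner_axis using assms by measurable

section \<open>Integrals of conditionally centred noise\<close>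

context prob_space
begin

lemma sigma_finite_subalgebra_of_subalgebra:
  assumes "subalgebra M H"
  shows "sigma_finite_subalgebra M H"
proof -
  interpret finite_measure_subalgebra M H
    by unfold_locales (use assms in auto)
  show ?thesis by unfold_locales
qed

lemma integrable_indicator_set_integrable:
  fixes h :: "'a \<Rightarrow> real"
  assumes "integrable M h" "G \<in> sets M"
  shows "set_integrable M G h"
  using assms unfolding set_integrable_def by (rule integrable_mult_indicator[rotated])

text \<open>
  The bound on the conditional second moment enters only in this integrated form, tested against
  events \<open>G\<close> known to \<open>H\<close>. The case where \<open>G\<close> is the whole space gives integrability.
\<close>

lemma integrable_square_noise:
  fixes e :: "'a \<Rightarrow> 'b::euclidean_space"
  assumes H: "subalgebra M H" and e[measurable]: "e \<in> borel_measurable M"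
    and bound: "AE \<omega> in M. nn_cond_exp M H (\<lambda>\<omega>. ennreal ((norm (e \<omega>))\<^sup>2)) \<omega> \<le> ennreal (s\<^sup>2)"
  shows "integrable M (\<lambda>\<omega>. (norm (e \<omega>))\<^sup>2)"
    and "G \<in> sets H \<Longrightarrow> (LINT \<omega>:G|M. (norm (e \<omega>))\<^sup>2) \<le> s\<^sup>2 * prob G"
proof -
  interpret sigma_finite_subalgebra M H
    by (rule sigma_finite_subalgebra_of_subalgebra[OF H])
  have main: "(\<integral>\<^sup>+\<omega>. indicator G \<omega> * ennreal ((norm (e \<omega>))\<^sup>2) \<partial>M) \<le> ennreal (s\<^sup>2 * prob G)"
    if G: "G \<in> sets H" for G
  proof -
    have GM: "G \<in> sets M" using G H by (auto simp: subalgebra_def)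
    have "(\<integral>\<^sup>+\<omega>. indicator G \<omega> * ennreal ((norm (e \<omega>))\<^sup>2) \<partial>M)
        = (\<integral>\<^sup>+\<omega>. indicator G \<omega> * nn_cond_exp M H (\<lambda>\<omega>. ennreal ((norm (e \<omega>))\<^sup>2)) \<omega> \<partial>M)"
      by (rule nn_cond_exp_intg[symmetric]) (use G in auto)
    also have "\<dots> \<le> (\<integral>\<^sup>+\<omega>. ennreal (s\<^sup>2) * indicator G \<omega> \<partial>M)"
      by (rule nn_integral_mono_AE) (use bound in \<open>auto simp: indicator_def\<close>)
    also have "\<dots> = ennreal (s\<^sup>2 * prob G)"
      using GM by (simp add: nn_integral_cmult_indicator emeasure_eq_measure ennreal_mult)
    finally show ?thesis .
  qed
  have "space M \<in> sets H" using H by (metis sets.top subalgebra_def)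
  then have "(\<integral>\<^sup>+\<omega>. indicator (space M) \<omega> * ennreal ((norm (e \<omega>))\<^sup>2) \<partial>M) < \<infinity>"
    using main[of "space M"] by (auto simp: le_less_trans)
  then have "(\<integral>\<^sup>+\<omega>. ennreal ((norm (e \<omega>))\<^sup>2) \<partial>M) < \<infinity>"
    by (subst (asm) nn_integral_cong[where v = "\<lambda>\<omega>. ennreal ((norm (e \<omega>))\<^sup>2)"]) auto
  then show int: "integrable M (\<lambda>\<omega>. (norm (e \<omega>))\<^sup>2)"
    by (intro integrableI_nonneg) auto
  assume G: "G \<in> sets H"
  have GM[measurable]: "G \<in> sets M" using G H by (auto simp: subalgebra_def)
  have "ennreal (LINT \<omega>:G|M. (norm (e \<omega>))\<^sup>2) = (\<integral>\<^sup>+\<omega>. ennreal (indicator G \<omega> * (norm (e \<omega>))\<^sup>2) \<partial>M)"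
    unfolding set_lebesgue_integral_def real_scaleR_def
    by (rule nn_integral_eq_integral[symmetric])
      (use integrable_indicator_set_integrable[OF int GM] in \<open>auto simp: set_integrable_def\<close>)
  also have "\<dots> = (\<integral>\<^sup>+\<omega>. indicator G \<omega> * ennreal ((norm (e \<omega>))\<^sup>2) \<partial>M)"
    by (rule nn_integral_cong) (auto simp: indicator_def)
  also have "\<dots> \<le> ennreal (s\<^sup>2 * prob G)" by (rule main[OF G])
  finally show "(LINT \<omega>:G|M. (norm (e \<omega>))\<^sup>2) \<le> s\<^sup>2 * prob G"
    by (subst (asm) ennreal_le_iff) auto
qed

text \<open>
  The first moment bound is the Cauchy-Schwarz inequality relative to \<open>G\<close>. The proof integrates
  \<open>\<parallel>e\<parallel> \<le> \<parallel>e\<parallel>\<^sup>2 / (2 * t) + t / 2\<close>, whose best choice is \<open>t = s\<close>; values \<open>t > s\<close> are used, followed by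
  a limit, so that \<open>s = 0\<close> needs no separate treatment.
\<close>

lemma integral_norm_noise:
  fixes e :: "'a \<Rightarrow> 'b::euclidean_space"
  assumes H: "subalgebra M H" and e[measurable]: "e \<in> borel_measurable M"
    and s: "s \<ge> 0"
    and bound: "AE \<omega> in M. nn_cond_exp M H (\<lambda>\<omega>. ennreal ((norm (e \<omega>))\<^sup>2)) \<omega> \<le> ennreal (s\<^sup>2)"
  shows "integrable M (\<lambda>\<omega>. norm (e \<omega>))"
    and "G \<in> sets H \<Longrightarrow> (LINT \<omega>:G|M. norm (e \<omega>)) \<le> s * prob G"
proof -
  note sq = integrable_square_noise[OF H e bound]
  show int: "integrable M (\<lambda>\<omega>. norm (e \<omega>))"
    by (rule square_integrable_imp_integrable) (use sq in auto)
  assume G: "G \<in> sets H"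
  have GM[measurable]: "G \<in> sets M" using G H by (auto simp: subalgebra_def)
  have approx: "(LINT \<omega>:G|M. norm (e \<omega>)) \<le> t * prob G" if t: "t > s" for t
  proof -
    have "(LINT \<omega>:G|M. norm (e \<omega>)) \<le> (LINT \<omega>:G|M. (norm (e \<omega>))\<^sup>2 / (2 * t) + t / 2)"
    proof (intro set_integral_mono set_integral_add integrable_indicator_set_integrable GM int)
      fix \<omega>
      have "2 * t * norm (e \<omega>) \<le> (norm (e \<omega>))\<^sup>2 + t\<^sup>2"
        using sum_squares_bound[of t "norm (e \<omega>)"] by simp
      then show "norm (e \<omega>) \<le> (norm (e \<omega>))\<^sup>2 / (2 * t) + t / 2"
        using t s by (simp add: field_simps power2_eq_square)
    qed (use sq in auto)
    also have "\<dots> = (LINT \<omega>:G|M. (norm (e \<omega>))\<^sup>2) / (2 * t) + t / 2 * prob G"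
      using integrable_indicator_set_integrable[OF sq(1) GM]
      by (subst set_integral_add)
        (auto intro!: integrable_indicator_set_integrable simp: set_lebesgue_integral_def)
    also have "\<dots> \<le> s\<^sup>2 * prob G / (2 * t) + t / 2 * prob G"
      using sq(2)[OF G] t s by (simp add: divide_right_mono)
    also have "\<dots> \<le> t\<^sup>2 * prob G / (2 * t) + t / 2 * prob G"
      using t s by (intro add_right_mono divide_right_mono mult_right_mono power_mono) auto
    also have "\<dots> = t * prob G" using t s by (simp add: power2_eq_square field_simps)
    finally show ?thesis .
  qed
  show "(LINT \<omega>:G|M. norm (e \<omega>)) \<le> s * prob G"
  proof (rule field_le_epsilon)
    fix d :: real assume d: "d > 0"
    have "d * prob G \<le> d * 1" using d by (intro mult_left_mono) auto
    then show "(LINT \<omega>:G|M. norm (e \<omega>)) \<le> s * prob G + d"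
      using approx[of "s + d"] d unfolding distrib_right by linarith
  qed
qed

text \<open>
  A factor known to \<open>H\<close> can be pulled out of the conditional expectation, coordinate by
  coordinate; square integrability makes each product integrable.
\<close>

lemma integral_inner_noise_zero:
  fixes e W :: "'a \<Rightarrow> real ^ 'n"
  assumes H: "subalgebra M H" and e[measurable]: "e \<in> borel_measurable M"
    and W: "W \<in> borel_measurable H"
    and W2: "integrable M (\<lambda>\<omega>. (norm (W \<omega>))\<^sup>2)" and e2: "integrable M (\<lambda>\<omega>. (norm (e \<omega>))\<^sup>2)"
    and mean: "AE \<omega> in M. vec_cond_exp M H e \<omega> = 0"
  shows "integrable M (\<lambda>\<omega>. W \<omega> \<bullet> e \<omega>)"
    and "G \<in> sets H \<Longrightarrow> (LINT \<omega>:G|M. W \<omega> \<bullet> e \<omega>) = 0"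
proof -
  interpret sigma_finite_subalgebra M H
    by (rule sigma_finite_subalgebra_of_subalgebra[OF H])
  have WM[measurable]: "W \<in> borel_measurable M" by (rule measurable_from_subalg[OF H W])
  have intj: "integrable M (\<lambda>\<omega>. W \<omega> $ j * e \<omega> $ j)" for j
  proof (rule Bochner_Integration.integrable_bound[OF Bochner_Integration.integrable_add[OF W2 e2]])
    show "AE \<omega> in M. norm (W \<omega> $ j * e \<omega> $ j) \<le> norm ((norm (W \<omega>))\<^sup>2 + (norm (e \<omega>))\<^sup>2)"
    proof (rule AE_I2)
      fix \<omega>
      have "\<bar>W \<omega> $ j\<bar> * \<bar>e \<omega> $ j\<bar> \<le> norm (W \<omega>) * norm (e \<omega>)"
        by (intro mult_mono component_le_norm_cart) auto
      also have "\<dots> \<le> (norm (W \<omega>))\<^sup>2 + (norm (e \<omega>))\<^sup>2"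
        using sum_squares_bound[of "norm (W \<omega>)" "norm (e \<omega>)"]
          mult_nonneg_nonneg[OF norm_ge_zero[of "W \<omega>"] norm_ge_zero[of "e \<omega>"]] by linarith
      finally show "norm (W \<omega> $ j * e \<omega> $ j) \<le> norm ((norm (W \<omega>))\<^sup>2 + (norm (e \<omega>))\<^sup>2)"
        by (simp add: abs_mult)
    qed
  qed (intro borel_measurable_times borel_measurable_component WM e)
  show int: "integrable M (\<lambda>\<omega>. W \<omega> \<bullet> e \<omega>)"
    unfolding inner_vec_def by (auto intro: intj)
  assume G: "G \<in> sets H"
  have GM[measurable]: "G \<in> sets M" using G H by (auto simp: subalgebra_def)
  have zero: "(\<integral>\<omega>. (indicator G \<omega> * W \<omega> $ j) * e \<omega> $ j \<partial>M) = 0"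
    and intGj: "integrable M (\<lambda>\<omega>. (indicator G \<omega> * W \<omega> $ j) * e \<omega> $ j)" for j
  proof -
    show i: "integrable M (\<lambda>\<omega>. (indicator G \<omega> * W \<omega> $ j) * e \<omega> $ j)"
      using integrable_indicator_set_integrable[OF intj[of j] GM]
      by (simp add: set_integrable_def mult.assoc)
    have meas: "(\<lambda>\<omega>. indicator G \<omega> * W \<omega> $ j) \<in> borel_measurable H"
      using G borel_measurable_component[OF W] by measurable
    have "AE \<omega> in M. real_cond_exp M H (\<lambda>\<omega>'. e \<omega>' $ j) \<omega> = 0"
      using mean by eventually_elim (auto simp: vec_cond_exp_def vec_eq_iff)
    then have "(\<integral>\<omega>. (indicator G \<omega> * W \<omega> $ j) * real_cond_exp M H (\<lambda>\<omega>'. e \<omega>' $ j) \<omega> \<partial>M) = 0"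
      by (intro integral_eq_zero_AE) auto
    then show "(\<integral>\<omega>. (indicator G \<omega> * W \<omega> $ j) * e \<omega> $ j \<partial>M) = 0"
      using real_cond_exp_intg(2)[OF i meas borel_measurable_component[OF e]] by simp
  qed
  have "(LINT \<omega>:G|M. W \<omega> \<bullet> e \<omega>) = (\<integral>\<omega>. (\<Sum>j\<in>UNIV. (indicator G \<omega> * W \<omega> $ j) * e \<omega> $ j) \<partial>M)"
    unfolding set_lebesgue_integral_def inner_vec_def
    by (simp add: sum_distrib_left mult.assoc)
  also have "\<dots> = 0" using intGj zero by (subst Bochner_Integration.integral_sum) auto
  finally show "(LINT \<omega>:G|M. W \<omega> \<bullet> e \<omega>) = 0" .
qed

end


section \<open>Bounded partial sums\<close>

lemma partial_sums_bounded_not_eventually_ge: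
  fixes a :: "nat \<Rightarrow> real"
  assumes bounded: "\<And>K. (\<Sum>k<K. a k) \<le> D" and \<delta>: "\<delta> > 0"
  shows "\<not> eventually (\<lambda>k. \<delta> \<le> a k) sequentially"
proof
  assume "eventually (\<lambda>k. \<delta> \<le> a k) sequentially"
  then obtain N where N: "\<And>k. k \<ge> N \<Longrightarrow> \<delta> \<le> a k"
    by (auto simp: eventually_sequentially)
  obtain n :: nat where n: "(D - (\<Sum>k<N. a k)) / \<delta> < n"
    using reals_Archimedean2 by blast
  have "real n * \<delta> = (\<Sum>k=N..<N+n. \<delta>)" by simp
  also have "\<dots> \<le> (\<Sum>k=N..<N+n. a k)" by (intro sum_mono) (use N in auto)
  also have "\<dots> = (\<Sum>k<N+n. a k) - (\<Sum>k<N. a k)"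
    by (simp add: sum_diff_nat_ivl lessThan_atLeast0)
  also have "\<dots> \<le> D - (\<Sum>k<N. a k)" using bounded by simp
  finally show False using n \<delta> by (simp add: field_simps)
qed

section \<open>The incremental method adapted to a filtration\<close>

text \<open>
  \<open>F (Suc k) i\<close> is the information available after \<open>i\<close> steps of cycle \<open>Suc k\<close>. All that the analysis
  needs of this family is that it increases and that the initial point, the errors and the chosen subgradients are
  adapted to it, so the filtration is left abstract. A single deterministic \<open>\<nu>\<close> bounds the conditional
  second moments of all cycles.
\<close>

locale incremental_stochastic_subgradient = prob_space M
  for M :: "'w measure" +
  fixes F :: "nat \<Rightarrow> nat \<Rightarrow> 'w measure"
    and X :: "(real ^ 'n) set"
    and m :: nat
    and f :: "nat \<Rightarrow> real ^ 'n \<Rightarrow> real"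
    and C :: "nat \<Rightarrow> real"
    and \<alpha> \<nu> :: real
    and x :: "nat \<Rightarrow> 'w \<Rightarrow> real ^ 'n"
    and z g \<epsilon> :: "nat \<Rightarrow> nat \<Rightarrow> 'w \<Rightarrow> real ^ 'n"
  assumes X: "closed X" "convex X"
    and f_convex: "\<And>i. i \<in> {1..m} \<Longrightarrow> convex_on UNIV (f i)"
    and subgrad_ex: "\<And>i v. i \<in> {1..m} \<Longrightarrow> v \<in> X \<Longrightarrow> subdifferential (f i) v \<noteq> {}"
    and subgrad_bound: "\<And>i v w. i \<in> {1..m} \<Longrightarrow> v \<in> X \<Longrightarrow>
          w \<in> subdifferential (f i) v \<Longrightarrow> norm w \<le> C i"
    and step: "\<alpha> > 0"
    and nu_nonneg: "\<nu> \<ge> 0"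
    and F_subalgebra: "\<And>k i. subalgebra M (F (Suc k) i)"
    and F_within_cycle: "\<And>k i. i < m \<Longrightarrow> sets (F (Suc k) i) \<subseteq> sets (F (Suc k) (Suc i))"
    and F_next_cycle: "\<And>k. sets (F (Suc k) m) \<subseteq> sets (F (Suc (Suc k)) 0)"
    and x0_meas: "x 0 \<in> borel_measurable (F (Suc 0) 0)"
    and x0_in: "\<And>\<omega>. \<omega> \<in> space M \<Longrightarrow> x 0 \<omega> \<in> X"
    and eps_meas: "\<And>i k. i \<in> {1..m} \<Longrightarrow> \<epsilon> i (Suc k) \<in> borel_measurable (F (Suc k) i)"
    and subgrad: "\<And>i k \<omega>. i \<in> {1..m} \<Longrightarrow> \<omega> \<in> space M \<Longrightarrow>
          g i (Suc k) \<omega> \<in> subdifferential (f i) (z (i - 1) (Suc k) \<omega>)"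
    and subgrad_meas: "\<And>i k. i \<in> {1..m} \<Longrightarrow> g i (Suc k) \<in> borel_measurable (F (Suc k) (i - 1))"
    and z_start: "\<And>k \<omega>. \<omega> \<in> space M \<Longrightarrow> z 0 (Suc k) \<omega> = x k \<omega>"
    and z_step: "\<And>i k \<omega>. i \<in> {1..m} \<Longrightarrow> \<omega> \<in> space M \<Longrightarrow>
          z i (Suc k) \<omega> =
            closest_point X (z (i - 1) (Suc k) \<omega> - \<alpha> *\<^sub>R (g i (Suc k) \<omega> + \<epsilon> i (Suc k) \<omega>))"
    and x_z: "\<And>k \<omega>. \<omega> \<in> space M \<Longrightarrow> x (Suc k) \<omega> = z m (Suc k) \<omega>"
    and eps_mean: "\<And>i k. i \<in> {1..m} \<Longrightarrow>
          AE \<omega> in M. vec_cond_exp M (F (Suc k) (i - 1)) (\<epsilon> i (Suc k)) \<omega> = 0"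
    and eps_second_moment: "\<And>i k. i \<in> {1..m} \<Longrightarrow>
          AE \<omega> in M. nn_cond_exp M (F (Suc k) (i - 1))
              (\<lambda>\<omega>'. ennreal ((norm (\<epsilon> i (Suc k) \<omega>'))\<^sup>2)) \<omega> \<le> ennreal (\<nu>\<^sup>2)"
begin

definition fsum :: "real ^ 'n \<Rightarrow> real" where
  "fsum v = (\<Sum>i=1..m. f i v)"

text \<open>
  In units of \<open>\<alpha>\<^sup>2\<close>, the most that one cycle can add in expectation to the squared distance from a
  point with the same function value.
\<close>

definition cycle_error :: real where
  "cycle_error = ((\<Sum>i=1..m. C i) + real m * \<nu>)\<^sup>2"

lemma space_F: "space (F (Suc k) i) = space M"
  using F_subalgebra[of k i] by (simp add: subalgebra_def)

lemma sets_F: "G \<in> sets (F (Suc k) i) \<Longrightarrow> G \<in> sets M"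
  using F_subalgebra[of k i] by (auto simp: subalgebra_def)

lemma measurable_F: "h \<in> borel_measurable (F (Suc k) i) \<Longrightarrow> h \<in> borel_measurable M"
  using measurable_from_subalg[OF F_subalgebra] .

lemma measurable_F_mono:
  assumes "h \<in> borel_measurable (F (Suc k) i)" "sets (F (Suc k) i) \<subseteq> sets (F (Suc l) j)"
  shows "h \<in> borel_measurable (F (Suc l) j)"
  using assms by (auto simp: measurable_def space_F)

lemma sets_F_start: "i \<le> m \<Longrightarrow> sets (F (Suc k) 0) \<subseteq> sets (F (Suc k) i)"
proof (induction i)
  case (Suc i)
  then show ?case using F_within_cycle[of i k] by auto
qed simp

lemma X_nonempty: "X \<noteq> {}"
  using not_empty x0_in by blast

lemma C_nonneg: "i \<in> {1..m} \<Longrightarrow> C i \<ge> 0"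
  using X_nonempty subgrad_ex subgrad_bound by (meson all_not_in_conv norm_ge_zero order_trans)

lemma x_z_in_X:
  assumes "\<omega> \<in> space M"
  shows "x k \<omega> \<in> X" and "i \<le> m \<Longrightarrow> z i (Suc k) \<omega> \<in> X"
proof -
  have z: "z i (Suc k) \<omega> \<in> X" if "x k \<omega> \<in> X" "i \<le> m" for i k
  proof (cases i)
    case 0
    then show ?thesis using that assms z_start by simp
  next
    case (Suc j)
    then show ?thesis using that assms z_step[of i \<omega> k] closest_point_in_set[OF X(1) X_nonempty] by simp
  qed
  have x: "x k \<omega> \<in> X" for k
    by (induction k) (use x0_in x_z z assms in auto)
  show "x k \<omega> \<in> X" by (rule x)
  show "i \<le> m \<Longrightarrow> z i (Suc k) \<omega> \<in> X" by (rule z[OF x])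
qed

lemma z_measurable_if:
  assumes x: "x k \<in> borel_measurable (F (Suc k) 0)" and "i \<le> m"
  shows "z i (Suc k) \<in> borel_measurable (F (Suc k) i)"
  using assms(2)
proof (induction i)
  case 0
  then show ?case using x by (subst measurable_cong[OF z_start]) (auto simp: space_F)
next
  case (Suc i)
  have [measurable]: "z i (Suc k) \<in> borel_measurable (F (Suc k) (Suc i))"
    "g (Suc i) (Suc k) \<in> borel_measurable (F (Suc k) (Suc i))"
    "\<epsilon> (Suc i) (Suc k) \<in> borel_measurable (F (Suc k) (Suc i))"
    using Suc F_within_cycle[of i k] subgrad_meas[of "Suc i" k] eps_meas[of "Suc i" k]
    by (auto intro: measurable_F_mono)
  have cp [measurable]: "closest_point X \<in> borel_measurable borel"
    by (intro borel_measurable_continuous_onI continuous_on_closest_point X X_nonempty)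
  have "(\<lambda>\<omega>. closest_point X (z i (Suc k) \<omega> - \<alpha> *\<^sub>R (g (Suc i) (Suc k) \<omega> + \<epsilon> (Suc i) (Suc k) \<omega>)))
      \<in> borel_measurable (F (Suc k) (Suc i))"
    by measurable
  then show ?case using Suc.prems
    by (subst measurable_cong[OF z_step]) (auto simp: space_F)
qed

lemma x_measurable: "x k \<in> borel_measurable (F (Suc k) 0)"
proof (induction k)
  case (Suc k)
  have "z m (Suc k) \<in> borel_measurable (F (Suc (Suc k)) 0)"
    using measurable_F_mono[OF z_measurable_if[OF Suc] F_next_cycle] by simp
  then show ?case by (subst measurable_cong[OF x_z]) (auto simp: space_F)
qed (rule x0_meas)

lemma z_measurable: "i \<le> m \<Longrightarrow> z i (Suc k) \<in> borel_measurable (F (Suc k) i)"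
  using z_measurable_if[OF x_measurable] .

lemma f_measurable: "i \<in> {1..m} \<Longrightarrow> f i \<in> borel_measurable borel"
  by (intro borel_measurable_continuous_onI convex_on_continuous f_convex open_UNIV)

lemma fsum_measurable: "fsum \<in> borel_measurable borel"
  unfolding fsum_def[abs_def] by (intro borel_measurable_sum f_measurable)

lemma f_lipschitz:
  assumes "i \<in> {1..m}" "u \<in> X" "v \<in> X"
  shows "\<bar>f i u - f i v\<bar> \<le> C i * norm (u - v)"
proof -
  have le: "f i a - f i b \<le> C i * norm (a - b)" if "a \<in> X" for a b
    by (rule subgradient_lower_lipschitz) (use subgrad_ex subgrad_bound assms(1) that in auto)
  show ?thesis
    using le[of u v] le[of v u] assms(2,3) by (auto simp: abs_le_iff norm_minus_commute)
qed

lemma noise_square: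
  assumes i: "i \<in> {1..m}"
  shows "integrable M (\<lambda>\<omega>. (norm (\<epsilon> i (Suc k) \<omega>))\<^sup>2)"
    and "G \<in> sets (F (Suc k) (i - 1)) \<Longrightarrow> (LINT \<omega>:G|M. (norm (\<epsilon> i (Suc k) \<omega>))\<^sup>2) \<le> \<nu>\<^sup>2 * prob G"
  using integrable_square_noise[OF F_subalgebra measurable_F[OF eps_meas[OF i]] eps_second_moment[OF i]]
  by auto

lemma noise_norm:
  assumes i: "i \<in> {1..m}"
  shows "integrable M (\<lambda>\<omega>. norm (\<epsilon> i (Suc k) \<omega>))"
    and "G \<in> sets (F (Suc k) (i - 1)) \<Longrightarrow> (LINT \<omega>:G|M. norm (\<epsilon> i (Suc k) \<omega>)) \<le> \<nu> * prob G"
  using integral_norm_noise[OF F_subalgebra measurable_F[OF eps_meas[OF i]] nu_nonneg eps_second_moment[OF i]]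
  by auto

lemma integrable_norm_of_square:
  fixes h :: "'w \<Rightarrow> real ^ 'n"
  assumes "h \<in> borel_measurable M" "integrable M (\<lambda>\<omega>. (norm (h \<omega>))\<^sup>2)"
  shows "integrable M (\<lambda>\<omega>. norm (h \<omega>))"
  by (rule square_integrable_imp_integrable) (use assms in auto)

section \<open>Expected decrease over one cycle\<close>

text \<open>
  \<open>G\<close> is known at the start of the cycle, hence before each of its steps, so the first moment bound
  applies on \<open>G\<close> to every error of the cycle.
\<close>

lemma expected_drift:
  assumes "i \<le> m" and G: "G \<in> sets (F (Suc k) 0)"
  shows "integrable M (\<lambda>\<omega>. norm (z i (Suc k) \<omega> - x k \<omega>)) \<and>
    (LINT \<omega>:G|M. norm (z i (Suc k) \<omega> - x k \<omega>)) \<le> \<alpha> * (\<Sum>j=1..i. C j + \<nu>) * prob G"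
  using assms(1)
proof (induction i)
  case 0
  have "integrable M (\<lambda>\<omega>. norm (z 0 (Suc k) \<omega> - x k \<omega>)) \<longleftrightarrow> integrable M (\<lambda>\<omega>. 0::real)"
    by (rule Bochner_Integration.integrable_cong) (auto simp: z_start)
  moreover have "(LINT \<omega>:G|M. norm (z 0 (Suc k) \<omega> - x k \<omega>)) = (LINT \<omega>:G|M. 0)"
    using sets.sets_into_space[OF sets_F[OF G]]
    by (intro set_lebesgue_integral_cong sets_F[OF G]) (auto simp: z_start)
  ultimately show ?case by (simp add: set_lebesgue_integral_def)
next
  case (Suc i)
  define d where "d = (\<lambda>i \<omega>. norm (z i (Suc k) \<omega> - x k \<omega>))"
  define e where "e = \<epsilon> (Suc i) (Suc k)"
  have i: "Suc i \<in> {1..m}" "i \<le> m" using Suc by auto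
  have GM: "G \<in> sets M" using G sets_F by auto
  have Gi: "G \<in> sets (F (Suc k) (Suc i - 1))" using G sets_F_start[of i k] i by auto
  have IH: "integrable M (d i)" "(LINT \<omega>:G|M. d i \<omega>) \<le> \<alpha> * (\<Sum>j=1..i. C j + \<nu>) * prob G"
    using Suc.IH i by (auto simp: d_def)
  note e1 = noise_norm(1)[OF i(1), where k = k, folded e_def]
  have le: "d (Suc i) \<omega> \<le> d i \<omega> + \<alpha> * (C (Suc i) + norm (e \<omega>))" if "\<omega> \<in> space M" for \<omega>
  proof -
    have "norm (closest_point X (z i (Suc k) \<omega> - \<alpha> *\<^sub>R (g (Suc i) (Suc k) \<omega> + e \<omega>)) - z i (Suc k) \<omega>)
        \<le> \<alpha> * (C (Suc i) + norm (e \<omega>))"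
      by (rule projected_subgradient_step(2)[where h = "f (Suc i)" and x = "x k \<omega>" and y = "x k \<omega>"])
        (use X x_z_in_X[OF that] i subgrad_ex subgrad_bound subgrad[OF i(1) that, of k] step in auto)
    then have "norm (z (Suc i) (Suc k) \<omega> - z i (Suc k) \<omega>) \<le> \<alpha> * (C (Suc i) + norm (e \<omega>))"
      using z_step[OF i(1) that, of k] by (simp add: e_def)
    then show ?thesis
      using norm_triangle_ineq[of "z (Suc i) (Suc k) \<omega> - z i (Suc k) \<omega>" "z i (Suc k) \<omega> - x k \<omega>"]
      by (simp add: d_def)
  qed
  have bound_int: "integrable M (\<lambda>\<omega>. d i \<omega> + \<alpha> * (C (Suc i) + norm (e \<omega>)))"
    using IH(1) e1 by auto
  have int: "integrable M (d (Suc i))"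
  proof (rule Bochner_Integration.integrable_bound[OF bound_int])
    show "d (Suc i) \<in> borel_measurable M"
      using measurable_F[OF z_measurable[OF Suc.prems]] measurable_F[OF x_measurable]
      unfolding d_def by measurable
    show "AE \<omega> in M. norm (d (Suc i) \<omega>) \<le> norm (d i \<omega> + \<alpha> * (C (Suc i) + norm (e \<omega>)))"
    proof (rule AE_I2)
      fix \<omega> assume "\<omega> \<in> space M"
      moreover have "0 \<le> d (Suc i) \<omega>" by (simp add: d_def)
      ultimately show "norm (d (Suc i) \<omega>) \<le> norm (d i \<omega> + \<alpha> * (C (Suc i) + norm (e \<omega>)))"
        using le[of \<omega>] unfolding real_norm_def by linarith
    qed
  qed
  note set_int = integrable_indicator_set_integrable[OF _ GM]
  have "(LINT \<omega>:G|M. d (Suc i) \<omega>) \<le> (LINT \<omega>:G|M. d i \<omega> + \<alpha> * (C (Suc i) + norm (e \<omega>)))"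
    using le sets.sets_into_space[OF GM] by (intro set_integral_mono set_int int bound_int) auto
  also have "\<dots> = (LINT \<omega>:G|M. d i \<omega>) + \<alpha> * (C (Suc i) * prob G + (LINT \<omega>:G|M. norm (e \<omega>)))"
    using set_int[OF IH(1)] set_int[OF e1] set_int[of "\<lambda>_. C (Suc i)"] GM
    by (simp add: set_integral_add set_integral_const)
  also have "\<dots> \<le> \<alpha> * (\<Sum>j=1..i. C j + \<nu>) * prob G + \<alpha> * (C (Suc i) * prob G + \<nu> * prob G)"
    using noise_norm(2)[OF i(1) Gi] IH(2) step
    by (intro add_mono[OF _ mult_left_mono] add_left_mono) (auto simp: e_def)
  also have "\<dots> = \<alpha> * (\<Sum>j=1..Suc i. C j + \<nu>) * prob G"
    by (simp add: algebra_simps)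
  finally show ?case using int by (simp add: d_def)
qed

lemma integrable_f_diff:
  assumes i: "i \<in> {1..m}" and U: "U \<in> borel_measurable M" "\<And>\<omega>. \<omega> \<in> space M \<Longrightarrow> U \<omega> \<in> X"
    and V: "V \<in> borel_measurable M" "\<And>\<omega>. \<omega> \<in> space M \<Longrightarrow> V \<omega> \<in> X"
    and UV: "integrable M (\<lambda>\<omega>. (norm (U \<omega> - V \<omega>))\<^sup>2)"
  shows "integrable M (\<lambda>\<omega>. f i (U \<omega>) - f i (V \<omega>))"
proof (rule Bochner_Integration.integrable_bound)
  show "integrable M (\<lambda>\<omega>. C i * norm (U \<omega> - V \<omega>))"
    using integrable_norm_of_square[OF _ UV] U(1) V(1) by simp
  show "(\<lambda>\<omega>. f i (U \<omega>) - f i (V \<omega>)) \<in> borel_measurable M"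
    using f_measurable[OF i] U(1) V(1) by measurable
  show "AE \<omega> in M. norm (f i (U \<omega>) - f i (V \<omega>)) \<le> norm (C i * norm (U \<omega> - V \<omega>))"
    using f_lipschitz[OF i U(2) V(2)] C_nonneg[OF i] by (intro AE_I2) (simp add: abs_mult)
qed

text \<open>
  Write \<open>S\<close> for the sum of \<open>C j + \<nu>\<close> over the first \<open>i\<close> steps and \<open>c\<close> for the next constant \<open>C (i + 1)\<close>.
  Step \<open>i + 1\<close> contributes \<open>(c + \<nu>)\<^sup>2\<close> through the length of the step and \<open>2 * S * c\<close> through the
  distance from the start of the cycle. Enlarging the latter to \<open>2 * S * (c + \<nu>)\<close> completes the
  square \<open>(S + (c + \<nu>))\<^sup>2\<close>, which is why the errors accumulate as the square of a sum.
\<close>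

lemma expected_descent_within_cycle:
  assumes "i \<le> m" and G: "G \<in> sets (F (Suc k) 0)"
    and Y: "Y \<in> borel_measurable (F (Suc k) 0)" "\<And>\<omega>. \<omega> \<in> space M \<Longrightarrow> Y \<omega> \<in> X"
    and xY: "integrable M (\<lambda>\<omega>. (norm (x k \<omega> - Y \<omega>))\<^sup>2)"
  shows "integrable M (\<lambda>\<omega>. (norm (z i (Suc k) \<omega> - Y \<omega>))\<^sup>2) \<and>
    (LINT \<omega>:G|M. (norm (z i (Suc k) \<omega> - Y \<omega>))\<^sup>2) \<le> (LINT \<omega>:G|M. (norm (x k \<omega> - Y \<omega>))\<^sup>2)
      - 2 * \<alpha> * (\<Sum>j=1..i. LINT \<omega>:G|M. f j (x k \<omega>) - f j (Y \<omega>))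
      + \<alpha>\<^sup>2 * (\<Sum>j=1..i. C j + \<nu>)\<^sup>2 * prob G"
  using assms(1)
proof (induction i)
  case 0
  have "integrable M (\<lambda>\<omega>. (norm (z 0 (Suc k) \<omega> - Y \<omega>))\<^sup>2)"
    by (rule Bochner_Integration.integrable_cong[THEN iffD1, OF _ _ xY]) (auto simp: z_start)
  moreover have "(LINT \<omega>:G|M. (norm (z 0 (Suc k) \<omega> - Y \<omega>))\<^sup>2) = (LINT \<omega>:G|M. (norm (x k \<omega> - Y \<omega>))\<^sup>2)"
    using sets.sets_into_space[OF sets_F[OF G]]
    by (intro set_lebesgue_integral_cong sets_F[OF G]) (auto simp: z_start)
  ultimately show ?case by simp
next
  case (Suc i)
  define V where "V = (\<lambda>i \<omega>. (norm (z i (Suc k) \<omega> - Y \<omega>))\<^sup>2)"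
  define d where "d = (\<lambda>\<omega>. norm (z i (Suc k) \<omega> - x k \<omega>))"
  define D where "D = (\<lambda>\<omega>. f (Suc i) (x k \<omega>) - f (Suc i) (Y \<omega>))"
  define e where "e = \<epsilon> (Suc i) (Suc k)"
  define I where "I = (\<lambda>\<omega>. (z i (Suc k) \<omega> - Y \<omega>) \<bullet> e \<omega>)"
  define c where "c = C (Suc i)"
  define S where "S = (\<Sum>j=1..i. C j + \<nu>)"
  define R where "R = (\<lambda>\<omega>. V i \<omega> - 2 * \<alpha> * D \<omega> + 2 * \<alpha> * c * d \<omega> - 2 * \<alpha> * I \<omega>
       + \<alpha>\<^sup>2 * (c\<^sup>2 + 2 * c * norm (e \<omega>) + (norm (e \<omega>))\<^sup>2))"
  have i: "Suc i \<in> {1..m}" "i \<le> m" using Suc by auto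
  have GM: "G \<in> sets M" using G sets_F by auto
  have Gi: "G \<in> sets (F (Suc k) (Suc i - 1))" using G sets_F_start[of i k] i by auto
  have c0: "c \<ge> 0" using C_nonneg[OF i(1)] by (simp add: c_def)
  note YM = measurable_F[OF Y(1)] and xM = measurable_F[OF x_measurable]
  have W: "(\<lambda>\<omega>. z i (Suc k) \<omega> - Y \<omega>) \<in> borel_measurable (F (Suc k) (Suc i - 1))"
    using z_measurable[OF i(2), of k] measurable_F_mono[OF Y(1) sets_F_start[OF i(2)]] by simp
  have IH: "integrable M (V i)"
    "(LINT \<omega>:G|M. V i \<omega>) \<le> (LINT \<omega>:G|M. (norm (x k \<omega> - Y \<omega>))\<^sup>2)
      - 2 * \<alpha> * (\<Sum>j=1..i. LINT \<omega>:G|M. f j (x k \<omega>) - f j (Y \<omega>)) + \<alpha>\<^sup>2 * S\<^sup>2 * prob G"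
    using Suc.IH i by (auto simp: V_def S_def)
  have d1: "integrable M d" and dG: "(LINT \<omega>:G|M. d \<omega>) \<le> \<alpha> * S * prob G"
    using expected_drift[OF i(2) G] by (auto simp: d_def S_def)
  have D1: "integrable M D"
    unfolding D_def using integrable_f_diff[OF i(1) xM x_z_in_X(1) YM Y(2) xY] by simp
  have e1: "integrable M (\<lambda>\<omega>. norm (e \<omega>))" and e1G: "(LINT \<omega>:G|M. norm (e \<omega>)) \<le> \<nu> * prob G"
    and e2: "integrable M (\<lambda>\<omega>. (norm (e \<omega>))\<^sup>2)" and e2G: "(LINT \<omega>:G|M. (norm (e \<omega>))\<^sup>2) \<le> \<nu>\<^sup>2 * prob G"
    unfolding e_def using noise_norm[OF i(1), where k = k] noise_square[OF i(1), where k = k] Gi by auto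
  have I1: "integrable M I" and IG: "(LINT \<omega>:G|M. I \<omega>) = 0"
    unfolding I_def e_def
    using integral_inner_noise_zero[OF F_subalgebra measurable_F[OF eps_meas[OF i(1)]] W
        IH(1)[unfolded V_def] e2[unfolded e_def] eps_mean[OF i(1)]] Gi by auto
  have le: "V (Suc i) \<omega> \<le> R \<omega>" if "\<omega> \<in> space M" for \<omega>
  proof -
    have "(norm (closest_point X (z i (Suc k) \<omega> - \<alpha> *\<^sub>R (g (Suc i) (Suc k) \<omega> + e \<omega>)) - Y \<omega>))\<^sup>2
        \<le> V i \<omega> - 2 * \<alpha> * D \<omega> + 2 * \<alpha> * c * d \<omega> - 2 * \<alpha> * I \<omega> + \<alpha>\<^sup>2 * (c + norm (e \<omega>))\<^sup>2"
      unfolding V_def D_def c_def d_def I_def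
      by (rule projected_subgradient_step(1))
        (use X x_z_in_X[OF that] i subgrad_ex subgrad_bound subgrad[OF i(1) that, of k] Y(2)[OF that] step in auto)
    then have "V (Suc i) \<omega> \<le> V i \<omega> - 2 * \<alpha> * D \<omega> + 2 * \<alpha> * c * d \<omega> - 2 * \<alpha> * I \<omega> + \<alpha>\<^sup>2 * (c + norm (e \<omega>))\<^sup>2"
      using z_step[OF i(1) that, of k] by (simp add: V_def e_def)
    also have "\<dots> = R \<omega>" unfolding R_def by (simp add: power2_sum)
    finally show ?thesis .
  qed
  have R1: "integrable M R" unfolding R_def using IH(1) d1 D1 I1 e1 e2 by auto
  have int: "integrable M (V (Suc i))"
  proof (rule Bochner_Integration.integrable_bound[OF R1])
    show "V (Suc i) \<in> borel_measurable M"
      using measurable_F[OF z_measurable[OF Suc.prems]] YM unfolding V_def by measurable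
    show "AE \<omega> in M. norm (V (Suc i) \<omega>) \<le> norm (R \<omega>)"
    proof (rule AE_I2)
      fix \<omega> assume "\<omega> \<in> space M"
      moreover have "0 \<le> V (Suc i) \<omega>" by (simp add: V_def)
      ultimately show "norm (V (Suc i) \<omega>) \<le> norm (R \<omega>)"
        using le[of \<omega>] unfolding real_norm_def by linarith
    qed
  qed
  note set_int = integrable_indicator_set_integrable[OF _ GM]
  have "(LINT \<omega>:G|M. V (Suc i) \<omega>) \<le> (LINT \<omega>:G|M. R \<omega>)"
    using le sets.sets_into_space[OF GM] by (intro set_integral_mono set_int int R1) auto
  also have "\<dots> = (LINT \<omega>:G|M. V i \<omega>) - 2 * \<alpha> * (LINT \<omega>:G|M. D \<omega>) + 2 * \<alpha> * c * (LINT \<omega>:G|M. d \<omega>)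
      - 2 * \<alpha> * (LINT \<omega>:G|M. I \<omega>)
      + \<alpha>\<^sup>2 * (c\<^sup>2 * prob G + 2 * c * (LINT \<omega>:G|M. norm (e \<omega>)) + (LINT \<omega>:G|M. (norm (e \<omega>))\<^sup>2))"
    unfolding R_def
    using set_int[OF IH(1)] set_int[OF d1] set_int[OF D1] set_int[OF I1] set_int[OF e1] set_int[OF e2]
      set_int[of "\<lambda>_. c\<^sup>2"] GM
    by (simp add: set_integral_add set_integral_diff set_integral_const)
  also have "\<dots> \<le> (LINT \<omega>:G|M. V i \<omega>) - 2 * \<alpha> * (LINT \<omega>:G|M. D \<omega>) + 2 * \<alpha> * c * (\<alpha> * S * prob G)
      - 2 * \<alpha> * 0 + \<alpha>\<^sup>2 * (c\<^sup>2 * prob G + 2 * c * (\<nu> * prob G) + \<nu>\<^sup>2 * prob G)"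
    unfolding IG using dG e1G e2G c0 step
    by (intro add_mono diff_mono mult_left_mono order_refl) auto
  also have "\<dots> = (LINT \<omega>:G|M. V i \<omega>) - 2 * \<alpha> * (LINT \<omega>:G|M. D \<omega>)
      + \<alpha>\<^sup>2 * ((c + \<nu>)\<^sup>2 + 2 * S * c) * prob G"
    by (simp add: algebra_simps power2_eq_square)
  also have "\<dots> \<le> (LINT \<omega>:G|M. V i \<omega>) - 2 * \<alpha> * (LINT \<omega>:G|M. D \<omega>)
      + \<alpha>\<^sup>2 * ((c + \<nu>)\<^sup>2 + 2 * S * (c + \<nu>)) * prob G"
  proof -
    have "S \<ge> 0" unfolding S_def using C_nonneg i nu_nonneg by (intro sum_nonneg) (auto intro!: add_nonneg_nonneg)
    then show ?thesis using nu_nonneg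
      by (intro add_mono mult_left_mono mult_right_mono) auto
  qed
  also have "\<dots> \<le> (LINT \<omega>:G|M. (norm (x k \<omega> - Y \<omega>))\<^sup>2)
      - 2 * \<alpha> * (\<Sum>j=1..i. LINT \<omega>:G|M. f j (x k \<omega>) - f j (Y \<omega>)) + \<alpha>\<^sup>2 * S\<^sup>2 * prob G
      - 2 * \<alpha> * (LINT \<omega>:G|M. D \<omega>) + \<alpha>\<^sup>2 * ((c + \<nu>)\<^sup>2 + 2 * S * (c + \<nu>)) * prob G"
    using IH(2) by simp
  also have "\<dots> = (LINT \<omega>:G|M. (norm (x k \<omega> - Y \<omega>))\<^sup>2)
      - 2 * \<alpha> * ((\<Sum>j=1..i. LINT \<omega>:G|M. f j (x k \<omega>) - f j (Y \<omega>)) + (LINT \<omega>:G|M. D \<omega>))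
      + \<alpha>\<^sup>2 * (S + (c + \<nu>))\<^sup>2 * prob G"
    by (simp add: algebra_simps power2_eq_square)
  finally show ?case using int by (simp add: V_def D_def S_def c_def)
qed

lemma integrable_fsum_diff:
  assumes U: "U \<in> borel_measurable M" "\<And>\<omega>. \<omega> \<in> space M \<Longrightarrow> U \<omega> \<in> X"
    and V: "V \<in> borel_measurable M" "\<And>\<omega>. \<omega> \<in> space M \<Longrightarrow> V \<omega> \<in> X"
    and UV: "integrable M (\<lambda>\<omega>. (norm (U \<omega> - V \<omega>))\<^sup>2)"
  shows "integrable M (\<lambda>\<omega>. fsum (U \<omega>) - fsum (V \<omega>))"
  unfolding fsum_def sum_subtractf[symmetric]
  by (intro Bochner_Integration.integrable_sum integrable_f_diff assms)

lemma expected_descent_cycle: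
  assumes G: "G \<in> sets (F (Suc k) 0)"
    and Y: "Y \<in> borel_measurable (F (Suc k) 0)" "\<And>\<omega>. \<omega> \<in> space M \<Longrightarrow> Y \<omega> \<in> X"
    and xY: "integrable M (\<lambda>\<omega>. (norm (x k \<omega> - Y \<omega>))\<^sup>2)"
  shows "integrable M (\<lambda>\<omega>. (norm (x (Suc k) \<omega> - Y \<omega>))\<^sup>2)"
    and "(LINT \<omega>:G|M. (norm (x (Suc k) \<omega> - Y \<omega>))\<^sup>2) \<le> (LINT \<omega>:G|M. (norm (x k \<omega> - Y \<omega>))\<^sup>2)
      - 2 * \<alpha> * (LINT \<omega>:G|M. fsum (x k \<omega>) - fsum (Y \<omega>)) + \<alpha>\<^sup>2 * cycle_error * prob G"
proof -
  note main = expected_descent_within_cycle[OF order_refl assms]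
  have GM: "G \<in> sets M" using G sets_F by auto
  show "integrable M (\<lambda>\<omega>. (norm (x (Suc k) \<omega> - Y \<omega>))\<^sup>2)"
    by (rule Bochner_Integration.integrable_cong[THEN iffD1, OF _ _ main[THEN conjunct1]]) (auto simp: x_z)
  have "set_integrable M G (\<lambda>\<omega>. f j (x k \<omega>) - f j (Y \<omega>))" if "j \<in> {1..m}" for j
    using integrable_f_diff[OF that measurable_F[OF x_measurable] x_z_in_X(1) measurable_F[OF Y(1)] Y(2) xY] GM
    by (intro integrable_indicator_set_integrable) auto
  then have "(\<Sum>j=1..m. LINT \<omega>:G|M. f j (x k \<omega>) - f j (Y \<omega>)) = (LINT \<omega>:G|M. fsum (x k \<omega>) - fsum (Y \<omega>))"
    unfolding fsum_def sum_subtractf[symmetric] set_lebesgue_integral_def set_integrable_def scaleR_sum_right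
    by (intro Bochner_Integration.integral_sum[symmetric])
  moreover have "(\<Sum>j=1..m. C j + \<nu>)\<^sup>2 = cycle_error"
    by (simp add: cycle_error_def sum.distrib)
  moreover have "(LINT \<omega>:G|M. (norm (x (Suc k) \<omega> - Y \<omega>))\<^sup>2) = (LINT \<omega>:G|M. (norm (z m (Suc k) \<omega> - Y \<omega>))\<^sup>2)"
    using sets.sets_into_space[OF GM] by (intro set_lebesgue_integral_cong GM) (auto simp: x_z)
  ultimately show "(LINT \<omega>:G|M. (norm (x (Suc k) \<omega> - Y \<omega>))\<^sup>2) \<le> (LINT \<omega>:G|M. (norm (x k \<omega> - Y \<omega>))\<^sup>2)
      - 2 * \<alpha> * (LINT \<omega>:G|M. fsum (x k \<omega>) - fsum (Y \<omega>)) + \<alpha>\<^sup>2 * cycle_error * prob G"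
    using main by simp
qed


section \<open>Summation over the cycles\<close>

lemma sets_F_first: "sets (F (Suc 0) 0) \<subseteq> sets (F (Suc k) 0)"
proof (induction k)
  case (Suc k)
  then show ?case using sets_F_start[of m k] F_next_cycle[of k] by auto
qed simp

lemma x_measurable_later: "j \<le> k \<Longrightarrow> x j \<in> borel_measurable (F (Suc k) 0)"
proof (induction k)
  case 0
  then show ?case using x_measurable[of 0] by simp
next
  case (Suc k)
  show ?case
  proof (cases "j = Suc k")
    case True
    then show ?thesis using x_measurable by simp
  next
    case False
    then have "x j \<in> borel_measurable (F (Suc k) 0)" using Suc by simp
    then show ?thesis
      by (rule measurable_F_mono) (use sets_F_start[of m k] F_next_cycle[of k] in auto)
  qed
qed

lemma integrable_square_distance:
  assumes Y: "Y \<in> borel_measurable (F (Suc 0) 0)" "\<And>\<omega>. \<omega> \<in> space M \<Longrightarrow> Y \<omega> \<in> X"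
    and Y0: "integrable M (\<lambda>\<omega>. (norm (x 0 \<omega> - Y \<omega>))\<^sup>2)"
  shows "integrable M (\<lambda>\<omega>. (norm (x k \<omega> - Y \<omega>))\<^sup>2)"
proof (induction k)
  case (Suc k)
  \<comment> \<open>Integrability is independent of the event, so the empty one serves.\<close>
  show ?case
    by (rule expected_descent_cycle(1)[where G = "{}"])
      (use Suc Y measurable_F_mono[OF Y(1) sets_F_first] in auto)
qed (rule Y0)

text \<open>
  Shrinking the event from \<open>G k\<close> to \<open>G (Suc k)\<close> only lowers the integral of a nonnegative function,
  so the descent inequalities of the cycles can be chained even though each uses its own event.
\<close>

lemma telescoped_descent:
  assumes G: "\<And>k. G k \<in> sets (F (Suc k) 0)" "\<And>k. G (Suc k) \<subseteq> G k"
    and Y: "Y \<in> borel_measurable (F (Suc 0) 0)" "\<And>\<omega>. \<omega> \<in> space M \<Longrightarrow> Y \<omega> \<in> X"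
    and Y0: "integrable M (\<lambda>\<omega>. (norm (x 0 \<omega> - Y \<omega>))\<^sup>2)"
  shows "(\<Sum>k<K. (LINT \<omega>:G k|M. fsum (x k \<omega>) - fsum (Y \<omega>)) - \<alpha> / 2 * cycle_error * prob (G k))
      \<le> (LINT \<omega>:G 0|M. (norm (x 0 \<omega> - Y \<omega>))\<^sup>2) / (2 * \<alpha>)"
proof -
  define V where "V = (\<lambda>k. LINT \<omega>:G k|M. (norm (x k \<omega> - Y \<omega>))\<^sup>2)"
  define t where "t = (\<lambda>k. (LINT \<omega>:G k|M. fsum (x k \<omega>) - fsum (Y \<omega>)) - \<alpha> / 2 * cycle_error * prob (G k))"
  note int = integrable_square_distance[OF Y Y0]
  have GM: "G k \<in> sets M" for k using G(1) sets_F by blast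
  have step_le: "V (Suc k) \<le> V k - 2 * \<alpha> * t k" for k
  proof -
    have "V (Suc k) \<le> (LINT \<omega>:G k|M. (norm (x (Suc k) \<omega> - Y \<omega>))\<^sup>2)"
      unfolding V_def set_lebesgue_integral_def
      using integrable_indicator_set_integrable[OF int GM] G(2)[of k]
      by (intro integral_mono) (auto simp: set_integrable_def indicator_def)
    also have "\<dots> \<le> V k - 2 * \<alpha> * (LINT \<omega>:G k|M. fsum (x k \<omega>) - fsum (Y \<omega>)) + \<alpha>\<^sup>2 * cycle_error * prob (G k)"
      unfolding V_def
      using expected_descent_cycle(2)[OF G(1) measurable_F_mono[OF Y(1) sets_F_first] Y(2) int] by simp
    also have "\<dots> = V k - 2 * \<alpha> * t k"
      by (simp add: t_def algebra_simps power2_eq_square)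
    finally show ?thesis .
  qed
  have "V K + 2 * \<alpha> * (\<Sum>k<K. t k) \<le> V 0"
  proof (induction K)
    case (Suc K)
    then show ?case using step_le[of K] by (simp add: algebra_simps)
  qed simp
  moreover have "V K \<ge> 0" unfolding V_def set_lebesgue_integral_def by (intro integral_nonneg_AE) auto
  ultimately have "2 * \<alpha> * (\<Sum>k<K. t k) \<le> V 0" by linarith
  then show ?thesis using step by (simp add: t_def V_def field_simps)
qed

text \<open>
  The random comparison point. Falling back to \<open>x 0\<close> far out keeps it within bounded distance of
  the initial point, which makes all squared distances integrable.
\<close>

definition anchor :: "real ^ 'n \<Rightarrow> real \<Rightarrow> 'w \<Rightarrow> real ^ 'n" where
  "anchor v R \<omega> = (if norm (x 0 \<omega>) \<le> R then v else x 0 \<omega>)"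

lemma anchor_measurable: "anchor v R \<in> borel_measurable (F (Suc 0) 0)"
  using x0_meas unfolding anchor_def by measurable

lemma anchor_in_X: "v \<in> X \<Longrightarrow> \<omega> \<in> space M \<Longrightarrow> anchor v R \<omega> \<in> X"
  by (simp add: anchor_def x0_in)

lemma anchor_square_integrable: "integrable M (\<lambda>\<omega>. (norm (x 0 \<omega> - anchor v R \<omega>))\<^sup>2)"
proof (rule integrable_const_bound[where B = "(\<bar>R\<bar> + norm v)\<^sup>2"])
  show "AE \<omega> in M. norm ((norm (x 0 \<omega> - anchor v R \<omega>))\<^sup>2) \<le> (\<bar>R\<bar> + norm v)\<^sup>2"
  proof (rule AE_I2)
    fix \<omega>
    have "norm (x 0 \<omega> - anchor v R \<omega>) \<le> \<bar>R\<bar> + norm v"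
      using norm_triangle_ineq4[of "x 0 \<omega>" v] by (auto simp: anchor_def)
    then show "norm ((norm (x 0 \<omega> - anchor v R \<omega>))\<^sup>2) \<le> (\<bar>R\<bar> + norm v)\<^sup>2"
      by (simp add: power_mono)
  qed
  show "(\<lambda>\<omega>. (norm (x 0 \<omega> - anchor v R \<omega>))\<^sup>2) \<in> borel_measurable M"
    using measurable_F[OF x0_meas] measurable_F[OF anchor_measurable] by measurable
qed

lemma fsum_x_measurable: "(\<lambda>\<omega>. fsum (x k \<omega>)) \<in> borel_measurable M"
  using fsum_measurable measurable_F[OF x_measurable] by measurable

text \<open>
  With \<open>x 0\<close> as its own comparison point the initial distance is zero, so \<open>x k - x 0\<close> is square
  integrable for every initial distribution, and \<open>fsum\<close> is Lipschitz on \<open>X\<close>.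
\<close>

lemma integrable_fsum_x:
  assumes "integrable M (\<lambda>\<omega>. fsum (x 0 \<omega>))"
  shows "integrable M (\<lambda>\<omega>. fsum (x k \<omega>))"
proof -
  have "integrable M (\<lambda>\<omega>. (norm (x k \<omega> - x 0 \<omega>))\<^sup>2)"
    by (rule integrable_square_distance) (auto simp: x0_meas x0_in)
  then have "integrable M (\<lambda>\<omega>. fsum (x k \<omega>) - fsum (x 0 \<omega>))"
    by (intro integrable_fsum_diff measurable_F[OF x_measurable] x_z_in_X(1))
  from Bochner_Integration.integrable_add[OF this assms] show ?thesis by simp
qed

lemma expectation_anchor_tendsto:
  assumes int: "integrable M (\<lambda>\<omega>. fsum (x 0 \<omega>))"
  shows "integrable M (\<lambda>\<omega>. fsum (anchor v R \<omega>))"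
    and "(\<lambda>n. expectation (\<lambda>\<omega>. fsum (anchor v (real n) \<omega>))) \<longlonglongrightarrow> fsum v"
proof -
  have meas: "(\<lambda>\<omega>. fsum (anchor v R \<omega>)) \<in> borel_measurable M" for R
    using fsum_measurable measurable_F[OF anchor_measurable] by measurable
  have dom: "integrable M (\<lambda>\<omega>. \<bar>fsum v\<bar> + \<bar>fsum (x 0 \<omega>)\<bar>)" using int by auto
  show "integrable M (\<lambda>\<omega>. fsum (anchor v R \<omega>))"
    by (rule Bochner_Integration.integrable_bound[OF dom meas]) (auto simp: anchor_def)
  have "(\<lambda>n. expectation (\<lambda>\<omega>. fsum (anchor v (real n) \<omega>))) \<longlonglongrightarrow> expectation (\<lambda>\<omega>. fsum v)"
  proof (rule integral_dominated_convergence[OF _ meas dom])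
    show "AE \<omega> in M. (\<lambda>n. fsum (anchor v (real n) \<omega>)) \<longlonglongrightarrow> fsum v"
    proof (rule AE_I2)
      fix \<omega>
      obtain N :: nat where "norm (x 0 \<omega>) \<le> N" using real_arch_simple by blast
      then have "\<forall>n\<ge>N. fsum (anchor v (real n) \<omega>) = fsum v"
        by (auto simp: anchor_def)
      then show "(\<lambda>n. fsum (anchor v (real n) \<omega>)) \<longlonglongrightarrow> fsum v"
        by (intro tendsto_eventually) (auto simp: eventually_sequentially)
    qed
  qed (auto simp: anchor_def)
  then show "(\<lambda>n. expectation (\<lambda>\<omega>. fsum (anchor v (real n) \<omega>))) \<longlonglongrightarrow> fsum v"
    by (simp add: prob_space)
qed

text \<open>
  If the expected values eventually exceeded some \<open>r\<close> larger than the bound \<open>c\<close>, the excess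
  \<open>r - c = 3 * \<eta>\<close> could be shared: one \<open>\<eta>\<close> for the choice of a near-minimizer \<open>v\<close>, one for the truncation of \<open>x 0\<close>, and
  the last keeps the terms of the telescoped sum above \<open>\<eta>\<close>.
\<close>

theorem liminf_expectation_le:
  assumes int: "integrable M (\<lambda>\<omega>. fsum (x 0 \<omega>))" and bdd: "bdd_below (fsum ` X)"
  shows "liminf (\<lambda>k. ereal (expectation (\<lambda>\<omega>. fsum (x k \<omega>)))) \<le> ereal ((INF v\<in>X. fsum v) + \<alpha> / 2 * cycle_error)"
proof (rule ccontr)
  define c where "c = (INF v\<in>X. fsum v) + \<alpha> / 2 * cycle_error"
  assume "\<not> ?thesis"
  then have "ereal c < liminf (\<lambda>k. ereal (expectation (\<lambda>\<omega>. fsum (x k \<omega>))))"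
    by (simp add: c_def not_le)
  from ereal_dense2[OF this] obtain r where r: "c < r"
      "ereal r < liminf (\<lambda>k. ereal (expectation (\<lambda>\<omega>. fsum (x k \<omega>))))"
    by auto
  define \<eta> where "\<eta> = (r - c) / 3"
  have \<eta>: "\<eta> > 0" using r by (simp add: \<eta>_def)
  obtain v where v: "v \<in> X" "fsum v < (INF v\<in>X. fsum v) + \<eta>"
    using cINF_less_iff[OF X_nonempty bdd, of "(INF v\<in>X. fsum v) + \<eta>"] \<eta> by auto
  have "eventually (\<lambda>n. expectation (\<lambda>\<omega>. fsum (anchor v (real n) \<omega>)) < fsum v + \<eta>) sequentially"
    using order_tendstoD(2)[OF expectation_anchor_tendsto(2)[OF int, of v], of "fsum v + \<eta>"] \<eta> by simp
  then obtain n :: nat where n: "expectation (\<lambda>\<omega>. fsum (anchor v (real n) \<omega>)) < fsum v + \<eta>"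
    by (auto simp: eventually_sequentially)
  define Y where "Y = anchor v (real n)"
  define t where "t = (\<lambda>k. (LINT \<omega>:space M|M. fsum (x k \<omega>) - fsum (Y \<omega>)) - \<alpha> / 2 * cycle_error * prob (space M))"
  have t: "t k = expectation (\<lambda>\<omega>. fsum (x k \<omega>)) - expectation (\<lambda>\<omega>. fsum (Y \<omega>)) - \<alpha> / 2 * cycle_error" for k
    using integrable_fsum_x[OF int, of k] expectation_anchor_tendsto(1)[OF int, of v "real n"]
    by (simp add: t_def Y_def set_integral_space prob_space)
  have "(\<Sum>k<K. t k) \<le> (LINT \<omega>:space M|M. (norm (x 0 \<omega> - Y \<omega>))\<^sup>2) / (2 * \<alpha>)" for K
    unfolding t_def Y_def
    by (rule telescoped_descent[where G = "\<lambda>_. space M"])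
      (use anchor_measurable anchor_square_integrable anchor_in_X[OF v(1)] space_F sets.top in \<open>auto, metis\<close>)
  then have "\<not> eventually (\<lambda>k. \<eta> \<le> t k) sequentially"
    by (rule partial_sums_bounded_not_eventually_ge) (rule \<eta>)
  moreover have "eventually (\<lambda>k. \<eta> \<le> t k) sequentially"
    using less_LiminfD[OF r(2)]
  proof eventually_elim
    case (elim k)
    have "3 * \<eta> = r - c" by (simp add: \<eta>_def)
    then show ?case using elim n v(2) unfolding t Y_def c_def by simp
  qed
  ultimately show False by contradiction
qed

text \<open>
  \<open>G k\<close> is the event, known at the start of cycle \<open>k + 1\<close>, that \<open>norm (x 0) \<le> R\<close> and no value so far has come down to the
  bound plus \<open>\<eta>\<close>. On it \<open>fsum (x k)\<close> exceeds \<open>fsum v + \<alpha> / 2 * cycle_error\<close>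
  by at least \<open>\<eta> / 2\<close>, for a \<open>v\<close> within \<open>\<eta> / 2\<close> of the infimum, so the sum of the \<open>prob (G k)\<close> is finite
  and their intersection \<open>A\<close> is a null set.
\<close>

lemma AE_not_always_above:
  assumes bdd: "bdd_below (fsum ` X)" and \<eta>: "\<eta> > 0"
  shows "AE \<omega> in M. \<not> (norm (x 0 \<omega>) \<le> R \<and> (\<forall>k. (INF v\<in>X. fsum v) + \<alpha> / 2 * cycle_error + \<eta> < fsum (x k \<omega>)))"
proof -
  define c where "c = (INF v\<in>X. fsum v) + \<alpha> / 2 * cycle_error"
  obtain v where v: "v \<in> X" "fsum v < (INF v\<in>X. fsum v) + \<eta> / 2"
    using cINF_less_iff[OF X_nonempty bdd, of "(INF v\<in>X. fsum v) + \<eta> / 2"] \<eta> by auto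
  define Y where "Y = anchor v R"
  define G where "G = (\<lambda>k. {\<omega> \<in> space M. norm (x 0 \<omega>) \<le> R \<and> (\<forall>j\<in>{..k}. c + \<eta> < fsum (x j \<omega>))})"
  define A where "A = {\<omega> \<in> space M. norm (x 0 \<omega>) \<le> R \<and> (\<forall>k. c + \<eta> < fsum (x k \<omega>))}"
  have GF: "G k \<in> sets (F (Suc k) 0)" for k
  proof -
    have [measurable]: "x 0 \<in> borel_measurable (F (Suc k) 0)" using x_measurable_later[of 0 k] by simp
    have 1: "{\<omega> \<in> space (F (Suc k) 0). norm (x 0 \<omega>) \<le> R} \<in> sets (F (Suc k) 0)" by measurable
    have 2: "{\<omega> \<in> space (F (Suc k) 0). c + \<eta> < fsum (x j \<omega>)} \<in> sets (F (Suc k) 0)" if "j \<in> {..k}" for j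
    proof -
      have [measurable]: "x j \<in> borel_measurable (F (Suc k) 0)" using x_measurable_later that by simp
      note [measurable] = fsum_measurable
      show ?thesis by measurable
    qed
    have "G k = {\<omega> \<in> space (F (Suc k) 0). norm (x 0 \<omega>) \<le> R} \<inter>
        (\<Inter>j\<in>{..k}. {\<omega> \<in> space (F (Suc k) 0). c + \<eta> < fsum (x j \<omega>)})"
      by (auto simp: G_def space_F)
    then show ?thesis using 1 2 by auto
  qed
  have GM: "G k \<in> sets M" for k using GF sets_F by blast
  have AM: "A \<in> sets M"
    using fsum_x_measurable measurable_F[OF x0_meas] unfolding A_def by measurable
  have AG: "prob A \<le> prob (G k)" for k
    by (rule finite_measure_mono) (auto simp: A_def G_def GM[unfolded G_def])
  define t where "t = (\<lambda>k. (LINT \<omega>:G k|M. fsum (x k \<omega>) - fsum (Y \<omega>)) - \<alpha> / 2 * cycle_error * prob (G k))"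
  have Y: "Y \<in> borel_measurable (F (Suc 0) 0)" "\<And>\<omega>. \<omega> \<in> space M \<Longrightarrow> Y \<omega> \<in> X"
    "integrable M (\<lambda>\<omega>. (norm (x 0 \<omega> - Y \<omega>))\<^sup>2)"
    unfolding Y_def using anchor_measurable anchor_in_X[OF v(1)] anchor_square_integrable by auto
  have "(\<Sum>k<K. t k) \<le> (LINT \<omega>:G 0|M. (norm (x 0 \<omega> - Y \<omega>))\<^sup>2) / (2 * \<alpha>)" for K
    unfolding t_def by (rule telescoped_descent[OF GF _ Y]) (auto simp: G_def)
  note bounded = partial_sums_bounded_not_eventually_ge[OF this]
  have t_ge: "\<eta> / 2 * prob A \<le> t k" for k
  proof -
    have int: "set_integrable M (G k) (\<lambda>\<omega>. fsum (x k \<omega>) - fsum (Y \<omega>))"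
      by (intro integrable_indicator_set_integrable integrable_fsum_diff measurable_F[OF x_measurable]
          measurable_F[OF Y(1)] x_z_in_X(1) Y(2) integrable_square_distance[OF Y] GM)
    have "(\<alpha> / 2 * cycle_error + \<eta> / 2) * prob (G k) = (LINT \<omega>:G k|M. \<alpha> / 2 * cycle_error + \<eta> / 2)"
      using GM by (simp add: set_integral_const)
    also have "\<dots> \<le> (LINT \<omega>:G k|M. fsum (x k \<omega>) - fsum (Y \<omega>))"
    proof (intro set_integral_mono int integrable_indicator_set_integrable GM)
      fix \<omega> assume "\<omega> \<in> G k"
      then have "norm (x 0 \<omega>) \<le> R" "c + \<eta> < fsum (x k \<omega>)" by (auto simp: G_def)
      then show "\<alpha> / 2 * cycle_error + \<eta> / 2 \<le> fsum (x k \<omega>) - fsum (Y \<omega>)"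
        using v(2) by (simp add: Y_def anchor_def c_def)
    qed simp
    finally have "\<eta> / 2 * prob (G k) \<le> t k" by (simp add: t_def algebra_simps)
    moreover have "\<eta> / 2 * prob A \<le> \<eta> / 2 * prob (G k)" using AG \<eta> by (intro mult_left_mono) auto
    ultimately show ?thesis by linarith
  qed
  have "\<not> \<eta> / 2 * prob A > 0"
    using bounded[of "\<eta> / 2 * prob A"] t_ge by (auto simp: eventually_sequentially)
  then have "prob A = 0" using \<eta> measure_nonneg[of M A] by (simp add: zero_less_mult_iff)
  then have "AE \<omega> in M. \<omega> \<notin> A"
    using AM by (simp add: AE_iff_null_sets[symmetric] null_sets_def emeasure_eq_measure)
  then show ?thesis
    by (rule AE_mp) (auto simp: A_def c_def)
qed

theorem AE_INF_le:
  assumes bdd: "bdd_below (fsum ` X)"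
  shows "AE \<omega> in M. (INF k. fsum (x k \<omega>)) \<le> (INF v\<in>X. fsum v) + \<alpha> / 2 * cycle_error"
proof -
  define c where "c = (INF v\<in>X. fsum v) + \<alpha> / 2 * cycle_error"
  have "AE \<omega> in M. \<forall>n R :: nat. \<not> (norm (x 0 \<omega>) \<le> real R \<and> (\<forall>k. c + 1 / real (Suc n) < fsum (x k \<omega>)))"
    unfolding AE_all_countable c_def by (intro allI AE_not_always_above[OF bdd]) simp
  then show ?thesis
  proof (rule AE_mp, intro AE_I2 impI)
    fix \<omega>
    assume \<omega>: "\<omega> \<in> space M"
      and *: "\<forall>n R :: nat. \<not> (norm (x 0 \<omega>) \<le> real R \<and> (\<forall>k. c + 1 / real (Suc n) < fsum (x k \<omega>)))"
    obtain R :: nat where R: "norm (x 0 \<omega>) \<le> R" using real_arch_simple by blast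
    have bdd': "bdd_below (range (\<lambda>k. fsum (x k \<omega>)))"
      by (rule bdd_below_mono[OF bdd]) (use x_z_in_X(1)[OF \<omega>] in auto)
    have "(INF k. fsum (x k \<omega>)) \<le> c"
    proof (rule field_le_epsilon)
      fix \<eta> :: real assume "\<eta> > 0"
      then obtain n where n: "1 / real (Suc n) < \<eta>" using nat_approx_posE by blast
      obtain k where "fsum (x k \<omega>) \<le> c + 1 / real (Suc n)"
        using * R by (meson not_le)
      then show "(INF k. fsum (x k \<omega>)) \<le> c + \<eta>"
        using cINF_lower[OF bdd', of k] n by simp
    qed
    then show "(INF k. fsum (x k \<omega>)) \<le> (INF v\<in>X. fsum v) + \<alpha> / 2 * cycle_error" by (simp add: c_def)
  qed
qed

end


section \<open>The filtration generated by the errors\<close>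

text \<open>
  These facts identify the \<open>\<sigma>\<close>-algebras generated by the errors as an instance of the abstract
  filtration above.
\<close>

lemma error_history_generators_in_Pow:
  "{x0 -` A \<inter> space M | A. A \<in> sets borel} \<union>
    {eps j l -` A \<inter> space M | j l A. A \<in> sets borel \<and> j \<in> {1..m} \<and> 1 \<le> l \<and> (l < k \<or> l = k \<and> j \<le> i)}
    \<subseteq> Pow (space M)"
  by auto

lemma space_error_history: "space (error_history M m x0 eps k i) = space M"
  unfolding error_history_def by (rule space_measure_of[OF error_history_generators_in_Pow])

lemma sets_error_history:
  "sets (error_history M m x0 eps k i) = sigma_sets (space M)
    ({x0 -` A \<inter> space M | A. A \<in> sets borel} \<union>
     {eps j l -` A \<inter> space M | j l A. A \<in> sets borel \<and> j \<in> {1..m} \<and> 1 \<le> l \<and> (l < k \<or> l = k \<and> j \<le> i)})"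
  unfolding error_history_def by (rule sets_measure_of[OF error_history_generators_in_Pow])

lemma subalgebra_error_history:
  assumes "x0 \<in> borel_measurable M"
    and "\<And>j l. j \<in> {1..m} \<Longrightarrow> l \<ge> 1 \<Longrightarrow> eps j l \<in> borel_measurable M"
  shows "subalgebra M (error_history M m x0 eps k i)"
  unfolding subalgebra_def space_error_history sets_error_history
  by (intro conjI refl sets.sigma_sets_subset) (use assms in \<open>auto intro: measurable_sets\<close>)

lemma error_history_mono:
  assumes "i \<le> i'"
  shows "sets (error_history M m x0 eps k i) \<subseteq> sets (error_history M m x0 eps k i')"
  unfolding sets_error_history
  by (intro sigma_sets_mono') (use assms in fastforce)

lemma x0_measurable_error_history: "x0 \<in> borel_measurable (error_history M m x0 eps k i)"
  by (rule measurableI) (auto simp: space_error_history sets_error_history intro!: sigma_sets.Basic)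

lemma eps_measurable_error_history:
  fixes eps :: "nat \<Rightarrow> nat \<Rightarrow> 'a \<Rightarrow> real ^ 'b"
  assumes "i \<in> {1..m}" "k \<ge> 1"
  shows "eps i k \<in> borel_measurable (error_history M m x0 eps k i)"
proof (rule measurableI)
  fix A :: "(real ^ 'b) set" assume A: "A \<in> sets borel"
  show "eps i k -` A \<inter> space (error_history M m x0 eps k i) \<in> sets (error_history M m x0 eps k i)"
    unfolding space_error_history sets_error_history
    by (intro sigma_sets.Basic UnI2 CollectI exI[of _ A] exI[of _ i] exI[of _ k]) (use A assms in auto)
qed simp

theorem theorem3p5:
  fixes M :: "'w measure"
    and X :: "(real ^ 'n) set"
    and m :: nat
    and f :: "nat \<Rightarrow> real ^ 'n \<Rightarrow> real"
    and fsum :: "real ^ 'n \<Rightarrow> real"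
    and fstar :: real
    and C :: "nat \<Rightarrow> real"
    and \<alpha> :: real
    and x :: "nat \<Rightarrow> 'w \<Rightarrow> real ^ 'n"
    and z g \<epsilon> :: "nat \<Rightarrow> nat \<Rightarrow> 'w \<Rightarrow> real ^ 'n"
    and \<nu>s :: "nat \<Rightarrow> real"
    and \<nu> :: real
  assumes prob: "prob_space M"
    and X: "closed X" "convex X"
    and f_convex: "\<And>i. i \<in> {1..m} \<Longrightarrow> convex_on UNIV (f i)"
    and fsum: "fsum = (\<lambda>v. \<Sum>i=1..m. f i v)"
    and fstar_finite: "bdd_below (fsum ` X)"
    and fstar: "fstar = (INF v\<in>X. fsum v)"
    and subgrad_ex: "\<And>i v. i \<in> {1..m} \<Longrightarrow> v \<in> X \<Longrightarrow> subdifferential (f i) v \<noteq> {}"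
    and subgrad_bound: "\<And>i v w. i \<in> {1..m} \<Longrightarrow> v \<in> X \<Longrightarrow>
          w \<in> subdifferential (f i) v \<Longrightarrow> norm w \<le> C i"
    and step: "\<alpha> > 0"
    and x0_meas: "x 0 \<in> borel_measurable M"
    and x0_in: "\<And>\<omega>. \<omega> \<in> space M \<Longrightarrow> x 0 \<omega> \<in> X"
    and eps_meas: "\<And>i k. i \<in> {1..m} \<Longrightarrow> k \<ge> 1 \<Longrightarrow> \<epsilon> i k \<in> borel_measurable M"
    \<comment> \<open>\<open>g i (k + 1) \<omega>\<close> is the subgradient of \<open>f i\<close> used in the \<open>i\<close>-th step of cycle \<open>k + 1\<close>.
        It may be any subgradient at the current iterate, selected measurably from the past.\<close>
    and subgrad: "\<And>i k \<omega>. i \<in> {1..m} \<Longrightarrow> \<omega> \<in> space M \<Longrightarrow>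
          g i (k + 1) \<omega> \<in> subdifferential (f i) (z (i - 1) (k + 1) \<omega>)"
    and subgrad_meas: "\<And>i k. i \<in> {1..m} \<Longrightarrow>
          g i (k + 1) \<in> borel_measurable (error_history M m (x 0) \<epsilon> (k + 1) (i - 1))"
    and z_start: "\<And>k \<omega>. \<omega> \<in> space M \<Longrightarrow> z 0 (k + 1) \<omega> = x k \<omega>"
    and z_step: "\<And>i k \<omega>. i \<in> {1..m} \<Longrightarrow> \<omega> \<in> space M \<Longrightarrow>
          z i (k + 1) \<omega> =
            closest_point X
              (z (i - 1) (k + 1) \<omega> - \<alpha> *\<^sub>R (g i (k + 1) \<omega> + \<epsilon> i (k + 1) \<omega>))"
    and x_z: "\<And>k \<omega>. \<omega> \<in> space M \<Longrightarrow> x (k + 1) \<omega> = z m (k + 1) \<omega>"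
    and nu_nonneg: "\<And>k. k \<ge> 1 \<Longrightarrow> \<nu>s k \<ge> 0"
    and eps_mean: "\<And>i k. i \<in> {1..m} \<Longrightarrow> k \<ge> 1 \<Longrightarrow>
          AE \<omega> in M. vec_cond_exp M (error_history M m (x 0) \<epsilon> k (i - 1)) (\<epsilon> i k) \<omega> = 0"
    \<comment> \<open>As an \<open>ennreal\<close>-valued conditional expectation, this needs no prior integrability.\<close>
    and eps_second_moment: "\<And>i k. i \<in> {1..m} \<Longrightarrow> k \<ge> 1 \<Longrightarrow>
          AE \<omega> in M. nn_cond_exp M (error_history M m (x 0) \<epsilon> k (i - 1))
              (\<lambda>\<omega>'. ennreal ((norm (\<epsilon> i k \<omega>'))\<^sup>2)) \<omega> \<le> ennreal ((\<nu>s k)\<^sup>2)"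
    and nu_finite: "bdd_above (\<nu>s ` {1..})"
    and nu: "\<nu> = (SUP k\<in>{1..}. \<nu>s k)"
  \<comment> \<open>If \<open>fsum (x 0)\<close> is not integrable, then \<open>fsum (x k)\<close> has expectation \<open>\<infinity>\<close> for every \<open>k\<close>;
      the bound on the expectations is therefore about the integrable case.\<close>
  shows "(integrable M (\<lambda>\<omega>. fsum (x 0 \<omega>)) \<longrightarrow>
            (\<forall>k. integrable M (\<lambda>\<omega>. fsum (x k \<omega>))) \<and>
            liminf (\<lambda>k. ereal (\<integral>\<omega>. fsum (x k \<omega>) \<partial>M))
              \<le> ereal (fstar + \<alpha> / 2 * ((\<Sum>i=1..m. C i) + real m * \<nu>)\<^sup>2)) \<and>
         (AE \<omega> in M. (INF k. fsum (x k \<omega>))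
              \<le> fstar + \<alpha> / 2 * ((\<Sum>i=1..m. C i) + real m * \<nu>)\<^sup>2)"
proof -
  interpret prob_space M by (rule prob)
  have nu_le: "\<nu>s k \<le> \<nu>" if "k \<ge> 1" for k
    unfolding nu by (rule cSUP_upper) (use that nu_finite in auto)
  have nu0: "\<nu> \<ge> 0"
    using nu_nonneg[of 1] nu_le[of 1] by simp
  define F where "F = error_history M m (x 0) \<epsilon>"
  have moment: "AE \<omega> in M. nn_cond_exp M (F (Suc k) (i - 1))
      (\<lambda>\<omega>'. ennreal ((norm (\<epsilon> i (Suc k) \<omega>'))\<^sup>2)) \<omega> \<le> ennreal (\<nu>\<^sup>2)" if i: "i \<in> {1..m}" for i k
  proof -
    have le: "ennreal ((\<nu>s (Suc k))\<^sup>2) \<le> ennreal (\<nu>\<^sup>2)"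
      using nu_le[of "Suc k"] nu_nonneg[of "Suc k"] by (intro ennreal_leI power_mono) auto
    have "AE \<omega> in M. nn_cond_exp M (F (Suc k) (i - 1))
        (\<lambda>\<omega>'. ennreal ((norm (\<epsilon> i (Suc k) \<omega>'))\<^sup>2)) \<omega> \<le> ennreal ((\<nu>s (Suc k))\<^sup>2)"
      unfolding F_def by (rule eps_second_moment) (use i in auto)
    then show ?thesis by eventually_elim (rule order_trans[OF _ le])
  qed
  have mean: "AE \<omega> in M. vec_cond_exp M (F (Suc k) (i - 1)) (\<epsilon> i (Suc k)) \<omega> = 0" if "i \<in> {1..m}" for i k
    unfolding F_def by (rule eps_mean) (use that in auto)
  have F: "subalgebra M (F (Suc k) i)" "sets (F (Suc k) i) \<subseteq> sets (F (Suc k) (Suc i))"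
    "sets (F (Suc k) m) \<subseteq> sets (F (Suc (Suc k)) 0)" "x 0 \<in> borel_measurable (F (Suc 0) 0)" for k i
    unfolding F_def
    by (auto intro!: subalgebra_error_history x0_meas eps_meas error_history_mono x0_measurable_error_history
        simp: error_history_Suc_0)
  have eps: "\<epsilon> i (Suc k) \<in> borel_measurable (F (Suc k) i)" if "i \<in> {1..m}" for i k
    unfolding F_def by (rule eps_measurable_error_history) (use that in auto)
  interpret incremental_stochastic_subgradient M F X m f C \<alpha> \<nu> x z g \<epsilon>
    by unfold_locales
      (rule F(2) | fact X f_convex subgrad_ex subgrad_bound step nu0 F x0_in eps mean moment
        subgrad[unfolded Suc_eq_plus1[symmetric]] subgrad_meas[folded F_def, unfolded Suc_eq_plus1[symmetric]]
        z_start[unfolded Suc_eq_plus1[symmetric]] z_step[unfolded Suc_eq_plus1[symmetric]]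
        x_z[unfolded Suc_eq_plus1[symmetric]])+
  have fsum_eq: "incremental_stochastic_subgradient.fsum m f = fsum"
    unfolding assms(5) by (rule ext) (rule fsum_def)
  show ?thesis
    using liminf_expectation_le integrable_fsum_x AE_INF_le fstar_finite
    unfolding fsum_eq cycle_error_def fstar by blast
qed

end
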